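(* Let $t(x)$ be a term in one variable in the language $\{\cdot,\to,\top\}$ and let $\mathsf{V}(\mathbf{S}^\omega)$ be the variety generated by $\mathbf{S}^\omega$. Then $t(x)$ is a conucleus on $\mathsf{V}(\mathbf{S}^\omega)$ if and only if $\mathsf{V}(\mathbf{S}^\omega)\vDash t(x)\approx x$.
   Context: A hoop is an algebra $\langle A,\cdot,\to,\top\rangle$ such that $\langle A,\cdot,\top\rangle$ is a commutative monoid and $x\to x=\top$, $x\cdot(x\to y)=y\cdot(y\to x)$, $x\to(y\to z)=(x\cdot y)\to z$; it is partially ordered by $x\le y$ iff $x\to y=\top$. $\mathbf{S}^\omega$ is the hoop $\langle\mathbb{N}_0,+,\to,0\rangle$, where $\mathbb{N}_0=\{0,1,2,\dots\}$, the hoop multiplication is ordinary addition $+$, $i\to j=\max\{j-i,0\}$ and $\top=0$. A conucleus on a hoop $\mathbf{A}$ is a map $\delta\colon A\to A$ such that for all $a,b$: $\delta(a)\le a$; $a\le b$ implies $\delta(a)\le\delta(b)$; $\delta(\delta(a))=\delta(a)$; $\delta(a)\cdot\delta(b)\le\delta(a\cdot b)$; $\delta(a)\cdot\delta(\top)=\delta(a)$. A term $t(x)$ is a conucleus on a variety $\mathcal{V}$ of hoops if $t^{\mathbf{A}}$ is a conucleus on $\mathbf{A}$ for every $\mathbf{A}\in\mathcal{V}$. *)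

theory Defs
  imports "HOL-Algebra.Group"
begin

section \<open>Algebras in the language of hoops\<close>

record 'a hoop_algebra = "'a monoid" +
  imp :: "'a \<Rightarrow> 'a \<Rightarrow> 'a"  (infixr "\<leadsto>\<index>" 60)

locale hoop_language_algebra =
  fixes A (structure)
  assumes mult_closed: "\<lbrakk>x \<in> carrier A; y \<in> carrier A\<rbrakk> \<Longrightarrow> x \<otimes> y \<in> carrier A"
    and imp_closed: "\<lbrakk>x \<in> carrier A; y \<in> carrier A\<rbrakk> \<Longrightarrow> x \<leadsto> y \<in> carrier A"
    and top_closed: "\<one> \<in> carrier A"

text \<open>The constant \<open>\<top>\<close> of the hoop is the monoid unit \<open>\<one>\<close>.\<close>

locale hoop = comm_monoid A for A (structure) +
  assumes imp_closed: "\<lbrakk>x \<in> carrier A; y \<in> carrier A\<rbrakk> \<Longrightarrow> x \<leadsto> y \<in> carrier A"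
    and imp_self: "x \<in> carrier A \<Longrightarrow> x \<leadsto> x = \<one>"
    and mult_imp: "\<lbrakk>x \<in> carrier A; y \<in> carrier A\<rbrakk> \<Longrightarrow> x \<otimes> (x \<leadsto> y) = y \<otimes> (y \<leadsto> x)"
    and imp_imp: "\<lbrakk>x \<in> carrier A; y \<in> carrier A; z \<in> carrier A\<rbrakk>
      \<Longrightarrow> x \<leadsto> (y \<leadsto> z) = (x \<otimes> y) \<leadsto> z"

definition hoop_le :: "('a, 'm) hoop_algebra_scheme \<Rightarrow> 'a \<Rightarrow> 'a \<Rightarrow> bool"
    (infix "\<preceq>\<index>" 50)
  where "x \<preceq>\<^bsub>A\<^esub> y \<longleftrightarrow> x \<leadsto>\<^bsub>A\<^esub> y = \<one>\<^bsub>A\<^esub>"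

text \<open>Truncated subtraction on \<^typ>\<open>nat\<close> gives \<open>j - i = max {j - i, 0}\<close>. The hoop order of
  this algebra is the reverse of the usual order of the natural numbers.\<close>

definition S_omega :: "nat hoop_algebra"
  where "S_omega = \<lparr>carrier = UNIV, mult = (+), one = 0, imp = (\<lambda>i j. j - i)\<rparr>"

locale conucleus = hoop A for A (structure) +
  fixes \<delta> :: "'a \<Rightarrow> 'a"
  assumes closed: "a \<in> carrier A \<Longrightarrow> \<delta> a \<in> carrier A"
    and contracting: "a \<in> carrier A \<Longrightarrow> \<delta> a \<preceq> a"
    and monotone: "\<lbrakk>a \<in> carrier A; b \<in> carrier A; a \<preceq> b\<rbrakk> \<Longrightarrow> \<delta> a \<preceq> \<delta> b"
    and idempotent: "a \<in> carrier A \<Longrightarrow> \<delta> (\<delta> a) = \<delta> a"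
    and submultiplicative:
      "\<lbrakk>a \<in> carrier A; b \<in> carrier A\<rbrakk> \<Longrightarrow> \<delta> a \<otimes> \<delta> b \<preceq> \<delta> (a \<otimes> b)"
    and unital: "a \<in> carrier A \<Longrightarrow> \<delta> a \<otimes> \<delta> \<one> = \<delta> a"


section \<open>Terms, equations and varieties\<close>

datatype (vars: 'v) hoop_term =
    Var 'v
  | Mult "'v hoop_term" "'v hoop_term"
  | Imp "'v hoop_term" "'v hoop_term"
  | Top

primrec eval :: "('a, 'm) hoop_algebra_scheme \<Rightarrow> ('v \<Rightarrow> 'a) \<Rightarrow> 'v hoop_term \<Rightarrow> 'a" where
  "eval A v (Var x) = v x"
| "eval A v (Mult s t) = eval A v s \<otimes>\<^bsub>A\<^esub> eval A v t"
| "eval A v (Imp s t) = eval A v s \<leadsto>\<^bsub>A\<^esub> eval A v t"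
| "eval A v Top = \<one>\<^bsub>A\<^esub>"

text \<open>The unary term operation \<open>t\<^sup>A\<close>, for a term \<open>t\<close> in at most one variable: the
  constant assignment makes it independent of the name of that variable.\<close>

definition term_operation :: "('a, 'm) hoop_algebra_scheme \<Rightarrow> 'v hoop_term \<Rightarrow> 'a \<Rightarrow> 'a"
  where "term_operation A t a = eval A (\<lambda>_. a) t"

text \<open>An equation \<open>s \<approx> t\<close> is the pair \<open>(s, t)\<close>.\<close>

type_synonym equation = "nat hoop_term \<times> nat hoop_term"

definition satisfies :: "('a, 'm) hoop_algebra_scheme \<Rightarrow> equation \<Rightarrow> bool"
  where "satisfies A e \<longleftrightarrow>
    (\<forall>v. range v \<subseteq> carrier A \<longrightarrow> eval A v (fst e) = eval A v (snd e))"

definition class_satisfies :: "'a hoop_algebra set \<Rightarrow> equation \<Rightarrow> bool"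
  where "class_satisfies \<V> e \<longleftrightarrow> (\<forall>A\<in>\<V>. satisfies A e)"

text \<open>Varieties are equational classes.\<close>

definition equational_class :: "equation set \<Rightarrow> 'a hoop_algebra set"
  where "equational_class E = {A. hoop_language_algebra A \<and> (\<forall>e\<in>E. satisfies A e)}"

text \<open>The smallest variety containing \<open>\<K>\<close>. A variety is not a set of algebras over one type,
  so it is given here by its members whose elements are of type \<^typ>\<open>'a\<close>; this type
  need not be that of the elements of the generating algebras.\<close>

definition generated_variety :: "'b hoop_algebra set \<Rightarrow> 'a hoop_algebra set"
  where "generated_variety \<K> = \<Inter> {equational_class E | E. \<K> \<subseteq> equational_class E}"

definition conucleus_on_variety :: "'v hoop_term \<Rightarrow> 'a hoop_algebra set \<Rightarrow> bool"
  where "conucleus_on_variety t \<V> \<longleftrightarrow> (\<forall>A\<in>\<V>. conucleus A (term_operation A t))"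


section \<open>The variety generated by \<open>S_omega\<close> consists of hoops\<close>

lemma hoop_S_omega: "hoop S_omega"
  by unfold_locales (auto simp: S_omega_def Units_def)

lemma S_omega_in_generated_variety: "S_omega \<in> generated_variety {S_omega}"
  by (auto simp: generated_variety_def)

lemma generated_varietyD:
  assumes "(A :: 'a hoop_algebra) \<in> generated_variety {S_omega}"
  shows "hoop_language_algebra A"
    and "satisfies S_omega e \<Longrightarrow> satisfies A e"
proof -
  have S: "hoop_language_algebra S_omega"
    by unfold_locales (auto simp: S_omega_def)
  have *: "A \<in> equational_class E" if "\<forall>e\<in>E. satisfies S_omega e" for E
    using assms that S by (auto simp: generated_variety_def equational_class_def)
  show "hoop_language_algebra A"
    using *[of "{}"] by (simp add: equational_class_def)
  show "satisfies S_omega e \<Longrightarrow> satisfies A e"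
    using *[of "{e}"] by (simp add: equational_class_def)
qed

lemma generated_variety_hoop:
  assumes "(A :: 'a hoop_algebra) \<in> generated_variety {S_omega}"
  shows "hoop A"
proof -
  interpret hoop_language_algebra A
    using assms by (rule generated_varietyD)
  let ?v = "\<lambda>x y z (n::nat). if n = 0 then x else if n = 1 then y else z"
  let ?x = "Var 0 :: nat hoop_term" and ?y = "Var 1 :: nat hoop_term"
    and ?z = "Var 2 :: nat hoop_term"
  have eq: "eval A (?v x y z) s = eval A (?v x y z) t"
    if "satisfies S_omega (s, t)" "x \<in> carrier A" "y \<in> carrier A" "z \<in> carrier A" for s t x y z
  proof -
    have "range (?v x y z) \<subseteq> carrier A"
      using that by auto
    then show ?thesis
      using generated_varietyD(2)[OF assms that(1)] unfolding satisfies_def by simp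
  qed
  note sat = satisfies_def S_omega_def
  have nat_max: "i + (j - i) = max i j" for i j :: nat
    by simp
  show ?thesis
  proof unfold_locales
    fix x y z assume xyz: "x \<in> carrier A" "y \<in> carrier A" "z \<in> carrier A"
    show "x \<otimes>\<^bsub>A\<^esub> y \<otimes>\<^bsub>A\<^esub> z = x \<otimes>\<^bsub>A\<^esub> (y \<otimes>\<^bsub>A\<^esub> z)"
      using eq[of "Mult (Mult ?x ?y) ?z" "Mult ?x (Mult ?y ?z)", OF _ xyz] by (simp add: sat)
    show "x \<leadsto>\<^bsub>A\<^esub> (y \<leadsto>\<^bsub>A\<^esub> z) = (x \<otimes>\<^bsub>A\<^esub> y) \<leadsto>\<^bsub>A\<^esub> z"
      using eq[of "Imp ?x (Imp ?y ?z)" "Imp (Mult ?x ?y) ?z", OF _ xyz] by (simp add: sat add.commute)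
  next
    fix x y assume xy: "x \<in> carrier A" "y \<in> carrier A"
    show "x \<otimes>\<^bsub>A\<^esub> y = y \<otimes>\<^bsub>A\<^esub> x"
      using eq[of "Mult ?x ?y" "Mult ?y ?x", OF _ xy xy(1)] by (simp add: sat)
    show "x \<otimes>\<^bsub>A\<^esub> (x \<leadsto>\<^bsub>A\<^esub> y) = y \<otimes>\<^bsub>A\<^esub> (y \<leadsto>\<^bsub>A\<^esub> x)"
      using eq[of "Mult ?x (Imp ?x ?y)" "Mult ?y (Imp ?y ?x)", OF _ xy xy(1)] by (simp add: sat nat_max max.commute)
    show "x \<otimes>\<^bsub>A\<^esub> y \<in> carrier A" "x \<leadsto>\<^bsub>A\<^esub> y \<in> carrier A"
      using xy by (rule mult_closed imp_closed)+
  next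
    fix x assume x: "x \<in> carrier A"
    show "\<one>\<^bsub>A\<^esub> \<otimes>\<^bsub>A\<^esub> x = x"
      using eq[of "Mult Top ?x" ?x, OF _ x x x] by (simp add: sat)
    show "x \<otimes>\<^bsub>A\<^esub> \<one>\<^bsub>A\<^esub> = x"
      using eq[of "Mult ?x Top" ?x, OF _ x x x] by (simp add: sat)
    show "x \<leadsto>\<^bsub>A\<^esub> x = \<one>\<^bsub>A\<^esub>"
      using eq[of "Imp ?x ?x" Top, OF _ x x x] by (simp add: sat)
  qed (rule top_closed)
qed

end

(* On S_omega every unary term operation is homogeneous, hence of the form n \<mapsto> k * n with
   k = t(1). Contraction gives k >= 1 and idempotence gives k * k = k, so k = 1 and
   S_omega, hence the whole variety, satisfies t(x) = x. Since the members of the variety are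
   taken over a fixed type 'a, S_omega has to be copied to 'a, which needs 'a to be infinite;
   over a finite type all members are trivial, because the variety satisfies x \<rightarrow> xy = y. *)

theory Submission
  imports Defs
begin

lemma eval_cong: "(\<And>y. y \<in> vars t \<Longrightarrow> v y = w y) \<Longrightarrow> eval A v t = eval A w t"
  by (induction t) auto

lemma eval_single_variable:
  assumes "vars t \<subseteq> {x}"
  shows "eval A v t = term_operation A t (v x)"
  unfolding term_operation_def using assms by (intro eval_cong) auto

lemma (in hoop) conucleus_identity:
  assumes "\<And>a. a \<in> carrier A \<Longrightarrow> \<delta> a = a"
  shows "conucleus A \<delta>"
  by unfold_locales (simp_all add: assms hoop_le_def imp_self)

text \<open>Multiplication by \<open>n\<close> fixes 0 and distributes over both addition and
  truncated subtraction, so it is an endomorphism of \<open>S_omega\<close>. Term operations commute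
  with it, and it sends 1 to \<open>n\<close>.\<close>

lemma term_operation_S_omega_linear:
  "term_operation S_omega t n = n * term_operation S_omega t 1"
  by (induction t)
    (simp_all add: term_operation_def S_omega_def algebra_simps diff_mult_distrib2)

lemma conucleus_S_omega_term_eq_id:
  assumes "\<And>n. n \<le> term_operation S_omega t n"
    and "\<And>n. term_operation S_omega t (term_operation S_omega t n) = term_operation S_omega t n"
  shows "term_operation S_omega t n = n"
proof -
  let ?k = "term_operation S_omega t 1"
  \<comment> \<open>Linearity at \<open>?k\<close> turns the product into the term operation applied
    to \<open>?k\<close>, which is idempotence at 1.\<close>
  have "?k * ?k = ?k"
    by (rule trans[OF term_operation_S_omega_linear[symmetric] assms(2)])
  moreover have "?k \<ge> 1"
    by (rule assms(1))
  ultimately have "?k = 1"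
    by simp
  then show ?thesis
    using term_operation_S_omega_linear[of t n] by simp
qed

text \<open>Transport of structure along \<open>f\<close>. For injective \<open>f\<close> this is an
  isomorphic copy of \<open>S_omega\<close> inside the type \<open>'a\<close>.\<close>

definition copy_S_omega :: "(nat \<Rightarrow> 'a) \<Rightarrow> 'a hoop_algebra"
  where "copy_S_omega f = \<lparr>carrier = range f, mult = (\<lambda>x y. f (inv_into UNIV f x + inv_into UNIV f y)),
    one = f 0, imp = (\<lambda>x y. f (inv_into UNIV f y - inv_into UNIV f x))\<rparr>"

lemma eval_copy_S_omega:
  assumes "inj f"
  shows "eval (copy_S_omega f) (f \<circ> v) t = f (eval S_omega v t)"
  by (induction t) (simp_all add: copy_S_omega_def S_omega_def assms)

lemma copy_S_omega_in_generated_variety: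
  assumes "inj f"
  shows "copy_S_omega f \<in> generated_variety {S_omega}"
proof -
  have "satisfies (copy_S_omega f) e" if "satisfies S_omega e" for e
    unfolding satisfies_def
  proof (intro allI impI)
    fix v :: "nat \<Rightarrow> 'a" assume "range v \<subseteq> carrier (copy_S_omega f)"
    \<comment> \<open>Every assignment into the copy is the image under \<open>f\<close> of an
      assignment into \<open>S_omega\<close>, where the equation is known.\<close>
    then have "v = f \<circ> (inv_into UNIV f \<circ> v)"
      by (auto simp: fun_eq_iff copy_S_omega_def f_inv_into_f image_subset_iff)
    then show "eval (copy_S_omega f) v (fst e) = eval (copy_S_omega f) v (snd e)"
      using that eval_copy_S_omega[OF assms, of "inv_into UNIV f \<circ> v"]
      by (simp add: satisfies_def S_omega_def)
  qed
  moreover have "hoop_language_algebra (copy_S_omega f)"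
    by unfold_locales (auto simp: copy_S_omega_def)
  ultimately show ?thesis
    by (auto simp: generated_variety_def equational_class_def)
qed

lemma conucleus_copy_S_omega_term_eq_id:
  assumes "inj f" and "conucleus (copy_S_omega f) (term_operation (copy_S_omega f) t)"
  shows "term_operation S_omega t n = n"
proof -
  interpret conucleus "copy_S_omega f" "term_operation (copy_S_omega f) t"
    by (rule assms)
  have op: "term_operation (copy_S_omega f) t (f m) = f (term_operation S_omega t m)" for m
    using eval_copy_S_omega[OF assms(1), of "\<lambda>_. m" t] by (simp add: term_operation_def comp_def)
  have f: "f m \<in> carrier (copy_S_omega f)" for m
    by (simp add: copy_S_omega_def)
  \<comment> \<open>The hoop order reverses the usual one: contraction says that the truncated
    difference \<open>m - term_operation S_omega t m\<close> is 0.\<close>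
  have "m \<le> term_operation S_omega t m" for m
    using contracting[OF f, of m] assms(1) unfolding op
    by (simp add: hoop_le_def copy_S_omega_def inj_eq)
  moreover have "term_operation S_omega t (term_operation S_omega t m) = term_operation S_omega t m"
    for m
    using idempotent[OF f, of m] assms(1) by (simp add: op inj_eq)
  ultimately show ?thesis
    by (rule conucleus_S_omega_term_eq_id)
qed

text \<open>Members of the variety are cancellative, so on a finite carrier multiplication by
  \<open>x\<close> is a bijection and \<open>x\<close> is invertible. An inverse in such a hoop can
  only be the unit.\<close>

lemma finite_generated_variety_trivial:
  assumes A: "A \<in> generated_variety {S_omega}" and fin: "finite (carrier A)"
    and x: "x \<in> carrier A"
  shows "x = \<one>\<^bsub>A\<^esub>"
proof -
  interpret hoop A
    using A by (rule generated_variety_hoop)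
  have imp_mult: "a \<leadsto>\<^bsub>A\<^esub> (a \<otimes>\<^bsub>A\<^esub> b) = b" if "a \<in> carrier A" "b \<in> carrier A" for a b
  proof -
    let ?e = "(Imp (Var 0) (Mult (Var 0) (Var 1)), Var 1) :: equation"
    have "satisfies A ?e"
      by (rule generated_varietyD[OF A]) (simp add: satisfies_def S_omega_def)
    then show ?thesis
      unfolding satisfies_def using that
      by (auto dest!: spec[of _ "\<lambda>n. if n = 0 then a else b"])
  qed
  have imp_one: "a \<leadsto>\<^bsub>A\<^esub> \<one>\<^bsub>A\<^esub> = \<one>\<^bsub>A\<^esub>" if "a \<in> carrier A" for a
  proof -
    let ?e = "(Imp (Var 0) Top, Top) :: equation"
    have "satisfies A ?e"
      by (rule generated_varietyD[OF A]) (simp add: satisfies_def S_omega_def)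
    then show ?thesis
      unfolding satisfies_def using that by (auto dest!: spec[of _ "\<lambda>_. a"])
  qed
  have "inj_on ((\<otimes>\<^bsub>A\<^esub>) x) (carrier A)"
    by (rule inj_on_inverseI[of _ "\<lambda>b. x \<leadsto>\<^bsub>A\<^esub> b"]) (simp add: imp_mult x)
  then have "(\<otimes>\<^bsub>A\<^esub>) x ` carrier A = carrier A"
    using fin x by (intro endo_inj_surj) auto
  then obtain y where y: "y \<in> carrier A" "x \<otimes>\<^bsub>A\<^esub> y = \<one>\<^bsub>A\<^esub>"
    by (metis imageE one_closed)
  \<comment> \<open>Here \<open>y\<close> equals x \<rightarrow> xy, which is x \<rightarrow> 1,
    hence the unit.\<close>
  then have "y = \<one>\<^bsub>A\<^esub>"
    using imp_mult[OF x y(1)] imp_one[OF x] by simp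
  then show ?thesis
    using y x by simp
qed

theorem proposition4p4:
  fixes t :: "nat hoop_term" and x :: nat
  assumes "vars t \<subseteq> {x}"
  shows "conucleus_on_variety t (generated_variety {S_omega} :: 'a hoop_algebra set) \<longleftrightarrow>
    class_satisfies (generated_variety {S_omega} :: 'a hoop_algebra set) (t, Var x)"
proof
  assume con: "conucleus_on_variety t (generated_variety {S_omega} :: 'a hoop_algebra set)"
  show "class_satisfies (generated_variety {S_omega} :: 'a hoop_algebra set) (t, Var x)"
    unfolding class_satisfies_def
  proof
    fix A :: "'a hoop_algebra" assume A: "A \<in> generated_variety {S_omega}"
    show "satisfies A (t, Var x)"
    proof (cases "finite (UNIV :: 'a set)")
      case True
      then have "finite (carrier A)"
        by (rule finite_subset[OF subset_UNIV])
      note trivial = finite_generated_variety_trivial[OF A this]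
      interpret conucleus A "term_operation A t"
        using con A by (simp add: conucleus_on_variety_def)
      show ?thesis
        unfolding satisfies_def
      proof (intro allI impI)
        fix v :: "nat \<Rightarrow> 'a" assume "range v \<subseteq> carrier A"
        then have v: "v x \<in> carrier A"
          by auto
        \<comment> \<open>Both sides lie in the carrier, the left one by closure of the conucleus,
          so both are the unit.\<close>
        show "eval A v (fst (t, Var x)) = eval A v (snd (t, Var x))"
          using trivial[OF v] trivial[OF closed[OF v]]
          by (simp add: eval_single_variable[OF assms])
      qed
    next
      case False
      then obtain f :: "nat \<Rightarrow> 'a" where f: "inj f"
        using infinite_countable_subset by blast
      have "conucleus (copy_S_omega f) (term_operation (copy_S_omega f) t)"
        using con copy_S_omega_in_generated_variety[OF f]
        by (simp add: conucleus_on_variety_def)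
      \<comment> \<open>The copy serves only to obtain the equation in \<open>S_omega\<close>, from
        where it passes to the arbitrary member \<open>A\<close>.\<close>
      then have "satisfies S_omega (t, Var x)"
        by (simp add: satisfies_def eval_single_variable[OF assms]
            conucleus_copy_S_omega_term_eq_id[OF f])
      with A show ?thesis
        by (rule generated_varietyD)
    qed
  qed
next
  assume sat: "class_satisfies (generated_variety {S_omega} :: 'a hoop_algebra set) (t, Var x)"
  show "conucleus_on_variety t (generated_variety {S_omega} :: 'a hoop_algebra set)"
    unfolding conucleus_on_variety_def
  proof
    fix A :: "'a hoop_algebra" assume A: "A \<in> generated_variety {S_omega}"
    have "term_operation A t a = a" if "a \<in> carrier A" for a
      using sat A that
      by (auto simp: class_satisfies_def satisfies_def term_operation_def image_subset_iff
          dest!: bspec[of _ _ A] spec[of _ "\<lambda>_. a"])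
    then show "conucleus A (term_operation A t)"
      by (rule hoop.conucleus_identity[OF generated_variety_hoop[OF A]])
  qed
qed

end
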